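(* Let $s\in[1/2,1)$, let $U\subseteq\mathbf R^d$ be open, let $x_0\in U$, and let $f\in\mathscr D'(U)$ and $g\in\mathcal E^s_{0,\infty}(\mathbf R^d)$ be such that $f\sim_{x_0}g$. Then $(x_0,\xi)\notin WF_s(f)$ for every $\xi\in\mathbf R^d\setminus\{0\}$. In particular, for $f\in\mathscr D'(U)$, $$\pi_1(WF_s(f))\subset \operatorname{sing\,supp}_{\infty,s}f .$$
   Context: Notation: $\langle\xi\rangle=(1+|\xi|^2)^{1/2}$; $\mathbf N$ denotes the nonnegative integers and $\mathbf Z_+$ the positive integers; the Fourier transform is $(\mathcal Ff)(\xi)=\widehat f(\xi)=(2\pi)^{-d/2}\int f(x)e^{-i\langle x,\xi\rangle}dx$, extended to $\mathscr S'(\mathbf R^d)$. For $x_0\in\mathbf R^d$ and $N\in\mathbf Z_+$, $E_{x_0,N}(x)=e^{-|x-x_0|^2/(4N)}$. An open cone is an open subset of $\mathbf R^d\setminus\{0\}$ invariant under multiplication by positive reals. The convention $0^0=1$ is used. $\pi_1(x,\xi)=x$ is the projection $\mathbf R^{2d}\to\mathbf R^d$. Relation: for $f\in\mathscr D'(X)$, $g\in\mathscr D'(Y)$ ($X,Y\subseteq\mathbf R^d$ open) and $x_0\in X\cap Y$, $f\sim_{x_0}g$ means that $f=g$ in an open neighborhood of $x_0$. Wave-front set: let $s\in[1/2,1)$, $X\subseteq\mathbf R^d$ open and $f\in\mathscr D'(X)$. A point $(x_0,\xi_0)\in X\times(\mathbf R^d\setminus\{0\})$ is a Gevrey regular point of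 order $s$ for $f$ if there exist $g\in\mathscr S'(\mathbf R^d)$, an open cone $\Gamma$ containing $\xi_0$, $C>0$ and $N_0\in\mathbf Z_+$ such that $f\sim_{x_0}g$ and, for every integer $N\ge N_0$, $|(\mathcal F(g\,E_{x_0,N}))(\xi)|\le C^{n+1}n^{sn}\langle\xi\rangle^{-n}$ for all $\xi\in\Gamma$ and all $n\in\mathbf N$ with $n\le N$. The set $WF_s(f)$ is the complement in $X\times(\mathbf R^d\setminus\{0\})$ of the set of Gevrey regular points of order $s$ for $f$. Space: $\mathcal E^s_{0,\infty}(\mathbf R^d)$ consists of all $\varphi\in C^\infty(\mathbf R^d)$ (tempered) with $\widehat\varphi\in L^\infty(\mathbf R^d)$ such that for some $h>0$, $\sup_{\alpha\in\mathbf N^d}\frac{h^{|\alpha|}\,\|\langle\xi\rangle^{|\alpha|}\widehat\varphi(\xi)\|_{L^\infty(\mathbf R^d)}}{\alpha!^s}<\infty$. Singular support: for $f\in\mathscr D'(U)$, $\operatorname{sing\,supp}_{\infty,s}f$ is the set of points $x\in U$ for which there does not exist any $g\in\mathcal E^s_{0,\infty}(\mathbf R^d)$ with $f\sim_{x}g$. *)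

theory Defs
  imports "HOL-Analysis.Analysis" "HOL-Probability.Essential_Supremum"
begin

text \<open>The space \<open>\<real>\<^sup>d\<close> is rendered as \<open>real ^ 'n\<close> with \<open>d = CARD('n)\<close>.\<close>

definition japanese :: "real ^ 'n \<Rightarrow> real" where
  "japanese x = sqrt (1 + (norm x)\<^sup>2)"

definition pdiff :: "'n \<Rightarrow> (real ^ 'n \<Rightarrow> complex) \<Rightarrow> real ^ 'n \<Rightarrow> complex" where
  "pdiff i f = (\<lambda>x. frechet_derivative f (at x) (axis i 1))"

text \<open>Iterated partial derivatives are indexed by lists of coordinate directions instead of
  multi-indices; the length of the list is the order of the derivative.\<close>

definition pdiffs :: "'n list \<Rightarrow> (real ^ 'n \<Rightarrow> complex) \<Rightarrow> real ^ 'n \<Rightarrow> complex" where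
  "pdiffs ds f = foldr pdiff ds f"

definition smooth :: "(real ^ 'n \<Rightarrow> complex) \<Rightarrow> bool" where
  "smooth f \<longleftrightarrow> (\<forall>ds. pdiffs ds f differentiable_on UNIV)"

text \<open>For open \<open>X\<close> this is \<open>C\<^sub>c\<^sup>\<infinity>(X)\<close>, with functions extended by zero to the whole space;
  for compact \<open>X\<close> it is the space of smooth functions supported in \<open>X\<close>.\<close>

definition test_functions :: "(real ^ 'n) set \<Rightarrow> (real ^ 'n \<Rightarrow> complex) set" where
  "test_functions X = {\<phi>. smooth \<phi> \<and> compact (closure {x. \<phi> x \<noteq> 0}) \<and> closure {x. \<phi> x \<noteq> 0} \<subseteq> X}"

definition schwartz_functions :: "(real ^ 'n \<Rightarrow> complex) set" where
  "schwartz_functions = {\<phi>. smooth \<phi> \<and>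
     (\<forall>k ds. bdd_above (range (\<lambda>x. japanese x ^ k * norm (pdiffs ds \<phi> x))))}"

text \<open>A distribution is a functional on all functions of which only the values on the relevant
  test function space are meaningful.\<close>

definition linear_functional_on ::
    "(real ^ 'n \<Rightarrow> complex) set \<Rightarrow> ((real ^ 'n \<Rightarrow> complex) \<Rightarrow> complex) \<Rightarrow> bool" where
  "linear_functional_on S u \<longleftrightarrow>
     (\<forall>\<phi>\<in>S. \<forall>\<psi>\<in>S. \<forall>a b. u (\<lambda>x. a * \<phi> x + b * \<psi> x) = a * u \<phi> + b * u \<psi>)"

definition distribution ::
    "(real ^ 'n) set \<Rightarrow> ((real ^ 'n \<Rightarrow> complex) \<Rightarrow> complex) \<Rightarrow> bool" where
  "distribution X u \<longleftrightarrow> linear_functional_on (test_functions X) u \<and>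
     (\<forall>K. compact K \<and> K \<subseteq> X \<longrightarrow>
       (\<exists>C k. \<forall>\<phi>\<in>test_functions K.
          norm (u \<phi>) \<le> C * (\<Sum>ds\<in>{ds. length ds \<le> k}. SUP x. norm (pdiffs ds \<phi> x))))"

definition tempered_distribution :: "((real ^ 'n \<Rightarrow> complex) \<Rightarrow> complex) \<Rightarrow> bool" where
  "tempered_distribution u \<longleftrightarrow> linear_functional_on schwartz_functions u \<and>
     (\<exists>C k. \<forall>\<phi>\<in>schwartz_functions.
        norm (u \<phi>) \<le>
          C * (\<Sum>ds\<in>{ds. length ds \<le> k}. SUP x. japanese x ^ k * norm (pdiffs ds \<phi> x)))"

definition dist_of_fun ::
    "(real ^ 'n \<Rightarrow> complex) \<Rightarrow> (real ^ 'n \<Rightarrow> complex) \<Rightarrow> complex" where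
  "dist_of_fun g = (\<lambda>\<phi>. LINT x|lborel. g x * \<phi> x)"

definition mult_dist ::
    "((real ^ 'n \<Rightarrow> complex) \<Rightarrow> complex) \<Rightarrow> (real ^ 'n \<Rightarrow> complex) \<Rightarrow>
     (real ^ 'n \<Rightarrow> complex) \<Rightarrow> complex" where
  "mult_dist u m = (\<lambda>\<phi>. u (\<lambda>x. m x * \<phi> x))"

definition eq_near ::
    "real ^ 'n \<Rightarrow> (real ^ 'n) set \<Rightarrow> ((real ^ 'n \<Rightarrow> complex) \<Rightarrow> complex) \<Rightarrow>
     (real ^ 'n) set \<Rightarrow> ((real ^ 'n \<Rightarrow> complex) \<Rightarrow> complex) \<Rightarrow> bool" where
  "eq_near x0 X f Y g \<longleftrightarrow>
     (\<exists>V. open V \<and> x0 \<in> V \<and> V \<subseteq> X \<inter> Y \<and> (\<forall>\<phi>\<in>test_functions V. f \<phi> = g \<phi>))"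

definition fourier :: "(real ^ 'n \<Rightarrow> complex) \<Rightarrow> real ^ 'n \<Rightarrow> complex" where
  "fourier \<phi> \<xi> = complex_of_real ((2 * pi) powr (- real CARD('n) / 2)) *
     (LINT x|lborel. \<phi> x * exp (- (\<i> * complex_of_real (x \<bullet> \<xi>))))"

definition fourier_dist ::
    "((real ^ 'n \<Rightarrow> complex) \<Rightarrow> complex) \<Rightarrow> (real ^ 'n \<Rightarrow> complex) \<Rightarrow> complex" where
  "fourier_dist u = (\<lambda>\<phi>. u (fourier \<phi>))"

text \<open>The tempered distribution \<open>u\<close> is (integration against) the function \<open>F\<close>. Integrability is
  demanded explicitly because the Bochner integral of a non-integrable function is 0.\<close>

definition tempered_is_fun ::
    "((real ^ 'n \<Rightarrow> complex) \<Rightarrow> complex) \<Rightarrow> (real ^ 'n \<Rightarrow> complex) \<Rightarrow> bool" where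
  "tempered_is_fun u F \<longleftrightarrow>
     (\<forall>\<phi>\<in>schwartz_functions. integrable lborel (\<lambda>x. F x * \<phi> x) \<and> u \<phi> = dist_of_fun F \<phi>)"

definition open_cone :: "(real ^ 'n) set \<Rightarrow> bool" where
  "open_cone \<Gamma> \<longleftrightarrow> open \<Gamma> \<and> 0 \<notin> \<Gamma> \<and> (\<forall>\<xi>\<in>\<Gamma>. \<forall>t>0. t *\<^sub>R \<xi> \<in> \<Gamma>)"

definition gauss :: "real ^ 'n \<Rightarrow> nat \<Rightarrow> real ^ 'n \<Rightarrow> complex" where
  "gauss x0 N x = complex_of_real (exp (- ((norm (x - x0))\<^sup>2 / (4 * real N))))"

text \<open>\<open>n\<^sup>s\<^sup>n\<close> with the convention \<open>0\<^sup>0 = 1\<close>; the case distinction is needed since \<open>0 powr 0 = 0\<close>.\<close>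

definition gevrey_weight :: "real \<Rightarrow> nat \<Rightarrow> real" where
  "gevrey_weight s n = (if n = 0 then 1 else real n powr (s * real n))"

text \<open>The Fourier transform of a tempered distribution times a Gaussian is a smooth function;
  its pointwise values are those of its (unique) continuous representative \<open>F\<close>.\<close>

definition gevrey_regular_point ::
    "real \<Rightarrow> (real ^ 'n) set \<Rightarrow> ((real ^ 'n \<Rightarrow> complex) \<Rightarrow> complex) \<Rightarrow>
     real ^ 'n \<Rightarrow> real ^ 'n \<Rightarrow> bool" where
  "gevrey_regular_point s X f x0 \<xi>0 \<longleftrightarrow>
     (\<exists>g \<Gamma> C N0. tempered_distribution g \<and> open_cone \<Gamma> \<and> \<xi>0 \<in> \<Gamma> \<and> C > 0 \<and> N0 \<ge> 1 \<and>
        eq_near x0 X f UNIV g \<and>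
        (\<forall>N\<ge>N0. \<exists>F. continuous_on UNIV F \<and>
           tempered_is_fun (fourier_dist (mult_dist g (gauss x0 N))) F \<and>
           (\<forall>\<xi>\<in>\<Gamma>. \<forall>n\<le>N.
              norm (F \<xi>) \<le> C ^ (n + 1) * gevrey_weight s n / japanese \<xi> ^ n)))"

definition WF ::
    "real \<Rightarrow> (real ^ 'n) set \<Rightarrow> ((real ^ 'n \<Rightarrow> complex) \<Rightarrow> complex) \<Rightarrow>
     ((real ^ 'n) \<times> (real ^ 'n)) set" where
  "WF s X f = {(x, \<xi>). x \<in> X \<and> \<xi> \<noteq> 0 \<and> \<not> gevrey_regular_point s X f x \<xi>}"

definition Linf_norm :: "(real ^ 'n \<Rightarrow> complex) \<Rightarrow> ennreal" where
  "Linf_norm F = esssup lborel (\<lambda>\<xi>. ennreal (norm (F \<xi>)))"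

text \<open>A smooth function \<open>\<phi>\<close> is tempered when it extends, from test functions to Schwartz
  functions, to a tempered distribution \<open>u\<close> (necessarily unique). The function \<open>\<Phi>\<close> is the
  Fourier transform of \<open>\<phi>\<close>.\<close>

definition E_space :: "real \<Rightarrow> (real ^ 'n \<Rightarrow> complex) set" where
  "E_space s = {\<phi>. smooth \<phi> \<and>
     (\<exists>u \<Phi>. tempered_distribution u \<and> (\<forall>\<psi>\<in>test_functions UNIV. u \<psi> = dist_of_fun \<phi> \<psi>) \<and>
        \<Phi> \<in> borel_measurable lborel \<and> Linf_norm \<Phi> < \<infinity> \<and> tempered_is_fun (fourier_dist u) \<Phi> \<and>
        (\<exists>h>0. (SUP \<alpha> :: 'n \<Rightarrow> nat.
            ennreal (h ^ (\<Sum>i\<in>UNIV. \<alpha> i) / (\<Prod>i\<in>UNIV. fact (\<alpha> i)) powr s) *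
            Linf_norm (\<lambda>\<xi>. complex_of_real (japanese \<xi> ^ (\<Sum>i\<in>UNIV. \<alpha> i)) * \<Phi> \<xi>)) < \<infinity>))}"

definition sing_supp ::
    "real \<Rightarrow> (real ^ 'n) set \<Rightarrow> ((real ^ 'n \<Rightarrow> complex) \<Rightarrow> complex) \<Rightarrow> (real ^ 'n) set" where
  "sing_supp s U f = {x \<in> U. \<not> (\<exists>g\<in>E_space s. eq_near x U f UNIV (dist_of_fun g))}"

end

theory Submission
  imports Defs "HOL-Probability.Characteristic_Functions" "HOL-Probability.Sinc_Integral"
begin

text \<open>A tempered extension \<open>u\<close> of \<open>g\<close> witnesses regularity in all directions at once. The Gaussian
  \<open>E\<^bsub>x\<^sub>0,N\<^esub>\<close> is the Fourier transform of the modulated Gaussian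
  \<open>K(y) = (N/\<pi>)\<^bsup>d/2\<^esup> exp (-N|y|\<^sup>2 + i\<langle>x\<^sub>0,y\<rangle>)\<close> (without the factor \<open>(2\<pi>)\<^bsup>-d/2\<^esup>\<close>), so multiplying a Fourier
  transform by it amounts to convolving with \<open>K\<close>. Hence the Fourier transform of \<open>u E\<^bsub>x\<^sub>0,N\<^esub>\<close> is
  \<open>F(\<xi>) = \<integral> \<Phi>(\<eta>) K(\<eta> - \<xi>) d\<eta>\<close> with \<open>\<Phi>\<close> the Fourier transform of \<open>u\<close>. By Peetre's inequality, the decay
  of order \<open>n\<close> of \<open>\<Phi>\<close> passes to \<open>F\<close> at the cost of \<open>2\<^bsup>n/2\<^esup> \<integral> \<langle>z\<rangle>\<^sup>n |K(z)| dz\<close>, and for \<open>n \<le> N\<close> the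
  bound \<open>\<langle>z\<rangle>\<^sup>n \<le> exp (N|z|\<^sup>2/2)\<close> makes this integral at most \<open>2\<^bsup>d/2\<^esup>\<close>, uniformly in \<open>N\<close>.\<close>

subsection \<open>Integration in coordinates and the Japanese bracket\<close>

text \<open>Fubini's theorem: Lebesgue measure on \<open>real ^ 'n\<close> is the image of a product
  measure over \<open>Basis\<close>, and \<open>axis\<close> reindexes that basis by the
  coordinates.\<close>

lemma
  fixes f :: "'n::finite \<Rightarrow> real \<Rightarrow> 'a::{real_normed_field,banach,second_countable_topology}"
  assumes f: "\<And>i. integrable lborel (f i)"
  shows integrable_prod_vec: "integrable lborel (\<lambda>x::real^'n. \<Prod>i\<in>UNIV. f i (x $ i))"
    and integral_prod_vec: "(LINT x|lborel. (\<Prod>i\<in>UNIV. f i ((x::real^'n) $ i))) = (\<Prod>i\<in>UNIV. (LINT t|lborel. f i t))"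
proof -
  interpret product_sigma_finite "\<lambda>_::real^'n. lborel :: real measure"
    by standard
  let ?P = "\<Pi>\<^sub>M b\<in>(Basis::(real^'n) set). (lborel :: real measure)"
  let ?T = "\<lambda>w::real^'n \<Rightarrow> real. \<Sum>b\<in>Basis. w b *\<^sub>R b"
  let ?g = "\<lambda>b. f (axis_index b)"
  have [measurable]: "f i \<in> borel_measurable borel" for i
    using borel_measurable_integrable[OF f[of i]] by simp
  have bij: "bij_betw (\<lambda>i. axis i (1::real)) UNIV (Basis::(real^'n) set)"
    by (auto simp: bij_betw_def inj_on_def axis_eq_axis Basis_vec_def)
  have reindex: "(\<Prod>b\<in>(Basis::(real^'n) set). h (axis_index b)) = (\<Prod>i\<in>UNIV. h i)" for h :: "'n \<Rightarrow> 'a"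
    using prod.reindex_bij_betw[OF bij, of "\<lambda>b. h (axis_index b)"] by simp
  have coord: "?T w $ i = w (axis i 1)" for w i
  proof -
    have "?T w $ i = ?T w \<bullet> axis i 1"
      by (simp add: inner_axis)
    also have "\<dots> = w (axis i 1)"
      by (subst inner_sum_left_Basis) auto
    finally show ?thesis .
  qed
  have eq: "(\<Prod>i\<in>UNIV. f i (?T w $ i)) = (\<Prod>b\<in>Basis. ?g b (w b))" for w
    unfolding coord by (subst prod.reindex_bij_betw[OF bij, symmetric]) simp
  have T [measurable]: "?T \<in> measurable ?P borel"
    by measurable
  have m [measurable]: "(\<lambda>x::real^'n. \<Prod>i\<in>UNIV. f i (x $ i)) \<in> borel_measurable borel"
    by measurable
  show "integrable lborel (\<lambda>x::real^'n. \<Prod>i\<in>UNIV. f i (x $ i))"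
    unfolding lborel_eq[where 'a="real^'n"]
    by (subst integrable_distr_eq[OF T m], unfold eq) (intro product_integrable_prod f finite_Basis)
  show "(LINT x|lborel. (\<Prod>i\<in>UNIV. f i ((x::real^'n) $ i))) = (\<Prod>i\<in>UNIV. (LINT t|lborel. f i t))"
    unfolding lborel_eq[where 'a="real^'n"]
    by (subst integral_distr[OF T m], unfold eq, subst product_integral_prod)
      (auto simp: f reindex[of "\<lambda>i. LINT t|lborel. f i t"])
qed

section \<open>The Japanese bracket: Peetre's inequality, exponential bounds, integrability\<close>

lemma japanese_ge_1: "1 \<le> japanese x"
  by (simp add: japanese_def)

lemma japanese_pos [simp]: "0 < japanese x"
  using japanese_ge_1[of x] by linarith

lemma japanese_minus [simp]: "japanese (- x) = japanese x"
  by (simp add: japanese_def)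

lemma japanese_power2: "(japanese x)\<^sup>2 = 1 + (norm x)\<^sup>2"
  by (simp add: japanese_def)

lemma continuous_on_japanese [continuous_intros]:
  "continuous_on A f \<Longrightarrow> continuous_on A (\<lambda>x. japanese (f x))"
  unfolding japanese_def by (intro continuous_intros)

lemma borel_measurable_japanese [measurable]: "japanese \<in> borel_measurable borel"
  by (intro borel_measurable_continuous_onI continuous_intros)

text \<open>Peetre's inequality. After squaring, the right side expands to the bound for the left
  side plus nonnegative terms.\<close>

lemma japanese_add_le: "japanese (x + y) \<le> sqrt 2 * japanese x * japanese y"
proof (rule power2_le_imp_le)
  have "norm (x + y) ^ 2 \<le> (norm x + norm y) ^ 2"
    by (intro power_mono norm_triangle_ineq) auto
  also have "\<dots> \<le> 2 * (norm x)\<^sup>2 + 2 * (norm y)\<^sup>2"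
    using sum_squares_bound[of "norm x" "norm y"] by (simp add: power2_sum)
  finally have "1 + norm (x + y) ^ 2 \<le> 2 * (1 + (norm x)\<^sup>2) * (1 + (norm y)\<^sup>2)"
    using mult_nonneg_nonneg[OF zero_le_power2[of "norm x"] zero_le_power2[of "norm y"]]
    unfolding ring_distribs by linarith
  then show "(japanese (x + y))\<^sup>2 \<le> (sqrt 2 * japanese x * japanese y)\<^sup>2"
    by (simp add: power_mult_distrib japanese_power2)
qed (simp add: less_imp_le)

lemma japanese_diff_power_le:
  "japanese x ^ k \<le> sqrt 2 ^ k * japanese y ^ k * japanese (x - y) ^ k"
  using power_mono[OF japanese_add_le[of y "x - y"], of k]
  by (simp add: power_mult_distrib less_imp_le)

text \<open>The square reduces to \<open>1 + t \<le> exp t\<close>. The factor 1/2 in the exponent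
  is essential: for \<open>n \<le> N\<close> it leaves half of the decay of
  \<open>gaussian N\<close> intact.\<close>

lemma japanese_power_le_exp: "japanese x ^ n \<le> exp (real n * (norm x)\<^sup>2 / 2)"
proof (rule power2_le_imp_le)
  have "(japanese x ^ n)\<^sup>2 = (1 + (norm x)\<^sup>2) ^ n"
    by (simp flip: power_mult add: mult.commute[of n] power_mult japanese_power2)
  also have "\<dots> \<le> exp ((norm x)\<^sup>2) ^ n"
    by (intro power_mono) auto
  also have "\<dots> = (exp (real n * (norm x)\<^sup>2 / 2))\<^sup>2"
    by (simp flip: exp_of_nat_mult)
  finally show "(japanese x ^ n)\<^sup>2 \<le> \<dots>" .
qed simp

text \<open>The free parameter \<open>c\<close> makes the exponential rate as small as desired, at
  the price of \<open>c ^ n\<close>, so that any Gaussian can absorb any power of the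
  bracket.\<close>

lemma japanese_power_le_scaled_exp:
  assumes "c \<ge> 1"
  shows "japanese x ^ n \<le> c ^ n * exp (real n * (norm x)\<^sup>2 / c)"
proof -
  have "japanese x \<le> (japanese x)\<^sup>2"
    using japanese_ge_1[of x] by (simp add: power2_eq_square)
  also have "\<dots> \<le> c * (1 + (norm x)\<^sup>2 / c)"
    using assms by (simp add: japanese_power2 field_simps)
  also have "\<dots> \<le> c * exp ((norm x)\<^sup>2 / c)"
    using assms by (intro mult_left_mono) auto
  finally have "japanese x ^ n \<le> (c * exp ((norm x)\<^sup>2 / c)) ^ n"
    by (intro power_mono) (auto simp: less_imp_le)
  then show ?thesis
    by (simp add: power_mult_distrib flip: exp_of_nat_mult)
qed

text \<open>The exponent is twice the dimension so that each coordinate receives one factor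
  \<open>1 + (norm x)\<^sup>2\<close>, which dominates the one-dimensional weight
  \<open>1 + (x $ i)\<^sup>2\<close> with integrable inverse.\<close>

lemma integrable_inverse_japanese:
  "integrable lborel (\<lambda>x::real^'n. inverse (japanese x ^ (2 * CARD('n))))"
proof (rule Bochner_Integration.integrable_bound)
  have "integrable lborel (\<lambda>t::real. inverse (1 + t\<^sup>2))"
    using integrable_inverse_1_plus_square by (simp add: set_integrable_def)
  then show "integrable lborel (\<lambda>x::real^'n. \<Prod>i\<in>UNIV. inverse (1 + (x $ i)\<^sup>2))"
    by (rule integrable_prod_vec)
  show "AE x in lborel. norm (inverse (japanese (x::real^'n) ^ (2 * CARD('n))))
          \<le> norm (\<Prod>i\<in>UNIV. inverse (1 + (x $ i)\<^sup>2))"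
  proof (rule AE_I2)
    fix x :: "real^'n"
    have "(\<Prod>i\<in>UNIV. 1 + (x $ i)\<^sup>2) \<le> (\<Prod>i\<in>(UNIV::'n set). 1 + (norm x)\<^sup>2)"
      by (intro prod_mono)
        (auto intro!: abs_le_square_iff[THEN iffD1] simp: component_le_norm_cart)
    also have "\<dots> = japanese x ^ (2 * CARD('n))"
      by (simp add: power_mult japanese_power2)
    finally have "(\<Prod>i\<in>UNIV. 1 + (x $ i)\<^sup>2) \<le> japanese x ^ (2 * CARD('n))" .
    then have "inverse (japanese x ^ (2 * CARD('n))) \<le> inverse (\<Prod>i\<in>UNIV. 1 + (x $ i)\<^sup>2)"
      by (intro le_imp_inverse_le prod_pos) (auto intro: add_pos_nonneg)
    then show "norm (inverse (japanese x ^ (2 * CARD('n)))) \<le> norm (\<Prod>i\<in>UNIV. inverse (1 + (x $ i)\<^sup>2))"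
      by (simp add: less_imp_le abs_prod comp_def flip: prod_inversef)
  qed
qed measurable

subsection \<open>Gaussians\<close>

lemma
  fixes a y :: real
  assumes a: "a > 0"
  shows integrable_gaussian_iexp_real:
      "integrable lborel (\<lambda>t. complex_of_real (sqrt (a / pi) * exp (- (a * t\<^sup>2))) * exp (- (\<i> * (y * t))))"
    and integral_gaussian_iexp_real:
      "(LINT t|lborel. complex_of_real (sqrt (a / pi) * exp (- (a * t\<^sup>2))) * exp (- (\<i> * (y * t))))
         = exp (- (y\<^sup>2 / (4 * a)))"
proof -
  \<comment> \<open>The substitution by \<open>c\<close> turns the Gaussian into the standard normal
    density, and \<open>u\<close> is the frequency after rescaling; the integral becomes the
    characteristic function of the normal distribution at \<open>u\<close>.\<close>
  define c where "c = sqrt (2 * a)"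
  define u where "u = - y / c"
  have c: "c > 0" "c\<^sup>2 = 2 * a"
    using a by (auto simp: c_def)
  let ?g = "\<lambda>x. std_normal_density x *\<^sub>R iexp (u * x)"
  have g: "integrable lborel ?g"
  proof (rule Bochner_Integration.integrable_bound)
    show "integrable lborel std_normal_density"
      by (rule integrable_normal_density) simp
  qed auto
  have sub: "c *\<^sub>R ?g (0 + c * t) = complex_of_real (sqrt (a / pi) * exp (- (a * t\<^sup>2))) * exp (- (\<i> * (y * t)))" for t
  proof -
    have "(c * t)\<^sup>2 / 2 = a * t\<^sup>2"
      using c by (simp add: power_mult_distrib)
    moreover have "c / sqrt (2 * pi) = sqrt (a / pi)"
      by (simp add: c_def real_sqrt_mult real_sqrt_divide)
    ultimately have "c * std_normal_density (c * t) = sqrt (a / pi) * exp (- (a * t\<^sup>2))"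
      by (simp add: std_normal_density_def field_simps)
    moreover have "u * (c * t) = - (y * t)"
      using c by (simp add: u_def)
    ultimately show ?thesis
      by (simp add: scaleR_conv_of_real mult.assoc flip: of_real_mult)
  qed
  have "integrable lborel (\<lambda>t. c *\<^sub>R ?g (0 + c * t))"
    using c by (intro integrable_scaleR_right impI lborel_integrable_real_affine[OF g]) simp
  then show "integrable lborel (\<lambda>t. complex_of_real (sqrt (a / pi) * exp (- (a * t\<^sup>2))) * exp (- (\<i> * (y * t))))"
    unfolding sub .
  have "exp (- (u\<^sup>2 / 2)) = char std_normal_distribution u"
    by (simp add: char_std_normal_distribution)
  also have "\<dots> = (LINT x|lborel. ?g x)"
    unfolding char_def by (subst integral_density) auto
  also have "\<dots> = (LINT t|lborel. c *\<^sub>R ?g (0 + c * t))"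
    using c lborel_integral_real_affine[of c ?g 0] by (simp only: integral_scaleR_right) simp
  also have "\<dots> = (LINT t|lborel. complex_of_real (sqrt (a / pi) * exp (- (a * t\<^sup>2))) * exp (- (\<i> * (y * t))))"
    unfolding sub ..
  also have "u\<^sup>2 / 2 = y\<^sup>2 / (4 * a)"
    using c by (simp add: u_def power_divide)
  finally show "(LINT t|lborel. complex_of_real (sqrt (a / pi) * exp (- (a * t\<^sup>2))) * exp (- (\<i> * (y * t))))
         = exp (- (y\<^sup>2 / (4 * a)))" ..
qed

text \<open>Normalised to have integral 1 when \<open>a > 0\<close>.\<close>

definition gaussian :: "real \<Rightarrow> real ^ 'n \<Rightarrow> real" where
  "gaussian a x = sqrt (a / pi) ^ CARD('n) * exp (- (a * (norm x)\<^sup>2))"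

lemma gaussian_nonneg [simp]: "a \<ge> 0 \<Longrightarrow> 0 \<le> gaussian a x"
  by (simp add: gaussian_def)

lemma gaussian_le: "a \<ge> 0 \<Longrightarrow> gaussian a (x :: real ^ 'n) \<le> sqrt (a / pi) ^ CARD('n)"
  by (simp add: gaussian_def mult_left_le)

lemma continuous_on_gaussian [continuous_intros]:
  "continuous_on A f \<Longrightarrow> continuous_on A (\<lambda>x. gaussian a (f x))"
  unfolding gaussian_def by (intro continuous_intros)

lemma borel_measurable_gaussian [measurable]: "gaussian a \<in> borel_measurable borel"
  by (intro borel_measurable_continuous_onI continuous_intros)

text \<open>The integrand is a product of functions of single coordinates, so the one-dimensional
  formula applies to each factor.\<close>

lemma
  fixes y :: "real ^ 'n"
  assumes a: "a > 0"
  shows integrable_gaussian_iexp: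
      "integrable lborel (\<lambda>x. complex_of_real (gaussian a x) * exp (- (\<i> * complex_of_real (y \<bullet> x))))"
    and integral_gaussian_iexp:
      "(LINT x|lborel. complex_of_real (gaussian a x) * exp (- (\<i> * complex_of_real (y \<bullet> x))))
         = exp (- ((norm y)\<^sup>2 / (4 * a)))"
proof -
  let ?f = "\<lambda>i t. complex_of_real (sqrt (a / pi) * exp (- (a * t\<^sup>2))) * exp (- (\<i> * (y $ i * t)))"
  have norm2: "(norm z)\<^sup>2 = (\<Sum>i\<in>UNIV. (z $ i)\<^sup>2)" for z :: "real ^ 'n"
    by (simp add: norm_vec_def L2_set_def sum_nonneg)
  have eq: "complex_of_real (gaussian a x) * exp (- (\<i> * complex_of_real (y \<bullet> x))) = (\<Prod>i\<in>UNIV. ?f i (x $ i))" for x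
    by (simp add: gaussian_def norm2 inner_vec_def prod.distrib exp_sum sum_distrib_left
        flip: sum_negf of_real_prod)
  show "integrable lborel (\<lambda>x. complex_of_real (gaussian a x) * exp (- (\<i> * complex_of_real (y \<bullet> x))))"
    unfolding eq by (intro integrable_prod_vec integrable_gaussian_iexp_real a)
  have "(LINT x|lborel. complex_of_real (gaussian a x) * exp (- (\<i> * complex_of_real (y \<bullet> x))))
      = (\<Prod>i\<in>UNIV. LINT t|lborel. ?f i t)"
    unfolding eq by (intro integral_prod_vec integrable_gaussian_iexp_real a)
  also have "\<dots> = (\<Prod>i\<in>UNIV. complex_of_real (exp (- ((y $ i)\<^sup>2 / (4 * a)))))"
    by (simp only: integral_gaussian_iexp_real[OF a])
  also have "\<dots> = exp (- ((norm y)\<^sup>2 / (4 * a)))"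
    by (simp add: norm2 exp_sum sum_divide_distrib flip: sum_negf of_real_prod)
  finally show "(LINT x|lborel. complex_of_real (gaussian a x) * exp (- (\<i> * complex_of_real (y \<bullet> x))))
         = exp (- ((norm y)\<^sup>2 / (4 * a)))" .
qed

lemma
  assumes "a > 0"
  shows integrable_gaussian: "integrable lborel (gaussian a :: real ^ 'n \<Rightarrow> real)"
    and integral_gaussian: "(LINT x|lborel. gaussian a (x :: real ^ 'n)) = 1"
  using integrable_gaussian_iexp[OF assms, of "0 :: real ^ 'n"]
    integral_gaussian_iexp[OF assms, of "0 :: real ^ 'n"]
  by (auto dest: integrable_Re)

text \<open>Giving up half of the exponent costs only the ratio of the two normalisations, which
  does not depend on \<open>a\<close>. This makes the final estimate uniform in
  \<open>N\<close>.\<close>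

lemma gaussian_mult_exp:
  "gaussian (2 * a) (x :: real ^ 'n) * exp (a * (norm x)\<^sup>2) = sqrt 2 ^ CARD('n) * gaussian a x"
proof -
  have "exp (- (2 * a * (norm x)\<^sup>2)) * exp (a * (norm x)\<^sup>2) = exp (- (a * (norm x)\<^sup>2))"
    by (simp flip: exp_add)
  moreover have "sqrt (2 * a / pi) = sqrt 2 * sqrt (a / pi)"
    by (simp flip: real_sqrt_mult)
  ultimately show ?thesis
    by (simp only: gaussian_def power_mult_distrib mult.assoc)
qed

lemma integrable_japanese_power_gaussian:
  assumes "a > 0"
  shows "integrable lborel (\<lambda>x :: real ^ 'n. japanese x ^ k * gaussian a x)"
proof (rule Bochner_Integration.integrable_bound)
  \<comment> \<open>Half of the exponent, \<open>b\<close>, is kept for integrability and the other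
    half is spent on the weight; \<open>c\<close> is large enough that the rate \<open>k / c\<close>
    stays below \<open>b\<close>, and at least 1 as the bracket bound requires.\<close>
  define b c where "b = a / 2" and "c = max 1 (real k / b)"
  have b: "b > 0" "a = 2 * b"
    using assms by (auto simp: b_def)
  show "integrable lborel (\<lambda>x :: real ^ 'n. c ^ k * (sqrt 2 ^ CARD('n) * gaussian b x))"
    using b by (intro integrable_mult_right integrable_gaussian) auto
  show "AE x :: real ^ 'n in lborel. norm (japanese x ^ k * gaussian a x)
      \<le> norm (c ^ k * (sqrt 2 ^ CARD('n) * gaussian b x))"
  proof (rule AE_I2)
    fix x :: "real ^ 'n"
    have "real k / c \<le> b"
      using b by (auto simp: c_def max_def field_simps)
    then have "real k * (norm x)\<^sup>2 / c \<le> b * (norm x)\<^sup>2"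
      using mult_right_mono[of "real k / c" b "(norm x)\<^sup>2"] by simp
    then have "c ^ k * exp (real k * (norm x)\<^sup>2 / c) \<le> c ^ k * exp (b * (norm x)\<^sup>2)"
      by (intro mult_left_mono) (auto simp: c_def)
    moreover have "japanese x ^ k \<le> c ^ k * exp (real k * (norm x)\<^sup>2 / c)"
      by (rule japanese_power_le_scaled_exp) (simp add: c_def)
    ultimately have "japanese x ^ k \<le> c ^ k * exp (b * (norm x)\<^sup>2)"
      by (rule order_trans[rotated])
    then have "japanese x ^ k * gaussian a x \<le> c ^ k * exp (b * (norm x)\<^sup>2) * gaussian a x"
      using assms by (intro mult_right_mono) auto
    also have "\<dots> = c ^ k * (gaussian (2 * b) x * exp (b * (norm x)\<^sup>2))"
      by (simp add: b)
    also have "\<dots> = c ^ k * (sqrt 2 ^ CARD('n) * gaussian b x)"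
      by (simp only: gaussian_mult_exp)
    finally have "japanese x ^ k * gaussian a x \<le> c ^ k * (sqrt 2 ^ CARD('n) * gaussian b x)" .
    moreover have "0 \<le> japanese x ^ k * gaussian a x"
      using assms by (simp add: less_imp_le)
    ultimately show "norm (japanese x ^ k * gaussian a x) \<le> norm (c ^ k * (sqrt 2 ^ CARD('n) * gaussian b x))"
      by (metis abs_of_nonneg order_trans real_norm_def)
  qed
qed measurable

subsection \<open>Convolution\<close>

text \<open>An affine map with scale factor -1 has Jacobian of modulus 1.\<close>

lemma distr_lborel_minus: "distr lborel borel (\<lambda>x. c - x) = (lborel :: 'a::euclidean_space measure)"
  using lborel_affine[of "-1::real" c] by (simp add: density_1)

lemma integrable_lborel_minus:
  fixes f :: "'a::euclidean_space \<Rightarrow> 'b::{banach,second_countable_topology}"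
  assumes "integrable lborel f"
  shows "integrable lborel (\<lambda>x. f (c - x))"
  using assms integrable_distr_eq[of "\<lambda>x. c - x" lborel borel f]
  by (simp add: distr_lborel_minus borel_measurable_integrable)

lemma integral_lborel_minus:
  fixes f :: "'a::euclidean_space \<Rightarrow> 'b::{banach,second_countable_topology}"
  assumes "f \<in> borel_measurable borel"
  shows "(LINT x|lborel. f (c - x)) = (LINT x|lborel. f x)"
  using assms integral_distr[of "\<lambda>x. c - x" lborel borel f]
  by (simp add: distr_lborel_minus)

text \<open>A translation is the composition of two reflections.\<close>

lemma
  fixes f :: "'a::euclidean_space \<Rightarrow> 'b::{banach,second_countable_topology}"
  assumes f: "integrable lborel f"
  shows integrable_lborel_shift: "integrable lborel (\<lambda>x. f (x - c))"
    and integral_lborel_shift: "(LINT x|lborel. f (x - c)) = (LINT x|lborel. f x)"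
proof -
  have f' [measurable]: "f \<in> borel_measurable borel"
    using borel_measurable_integrable[OF f] by simp
  show "integrable lborel (\<lambda>x. f (x - c))"
    using integrable_lborel_minus[OF integrable_lborel_minus[OF f, of 0], of c] by simp
  show "(LINT x|lborel. f (x - c)) = (LINT x|lborel. f x)"
    using integral_lborel_minus[of "\<lambda>x. f (0 - x)" c] integral_lborel_minus[of f 0] by simp
qed

section \<open>Convolution of functions: duality, Fourier transform, continuity\<close>

definition conv :: "('a::euclidean_space \<Rightarrow> complex) \<Rightarrow> ('a \<Rightarrow> complex) \<Rightarrow> 'a \<Rightarrow> complex" where
  "conv f g x = (LINT y|lborel. f y * g (x - y))"

lemma conv_commute:
  assumes [measurable]: "f \<in> borel_measurable borel" "g \<in> borel_measurable borel"
  shows "conv f g = conv g f"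
proof
  fix x
  show "conv f g x = conv g f x"
    using integral_lborel_minus[of "\<lambda>y. f y * g (x - y)" x] by (simp add: conv_def mult.commute)
qed

text \<open>Fubini's theorem, the double integral being dominated by
  \<open>norm (f y) * norm (g (x - y)) * B\<close>. The bound on \<open>h\<close> holds almost
  everywhere only, because \<open>h\<close> is later the function \<open>\<Phi>\<close>, which is
  controlled through an essential supremum.\<close>

lemma integral_conv_mult:
  fixes f g h :: "'a::euclidean_space \<Rightarrow> complex"
  assumes f: "integrable lborel f" and g: "integrable lborel g"
    and h [measurable]: "h \<in> borel_measurable borel" and B: "AE x in lborel. norm (h x) \<le> B"
  shows "(LINT x|lborel. conv f g x * h x)
      = (LINT y|lborel. f y * (LINT x|lborel. g (x - y) * h x))"
proof -
  have [measurable]: "f \<in> borel_measurable borel" "g \<in> borel_measurable borel"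
    using f g by (auto dest: borel_measurable_integrable)
  let ?H = "\<lambda>(y, x). f y * g (x - y) * h x"
  have le: "AE x in lborel. norm (f y * g (x - y) * h x) \<le> norm (f y) * (norm (g (x - y)) * B)" for y
    using B by eventually_elim (simp add: norm_mult mult.assoc mult_left_mono)
  have dom: "integrable lborel (\<lambda>x. norm (f y) * (norm (g (x - y)) * B))" for y
    by (intro integrable_mult_right integrable_mult_left integrable_norm integrable_lborel_shift g)
  have sec: "integrable lborel (\<lambda>x. f y * g (x - y) * h x)" for y
  proof (rule Bochner_Integration.integrable_bound[OF dom])
    show "AE x in lborel. norm (f y * g (x - y) * h x) \<le> norm (norm (f y) * (norm (g (x - y)) * B))"
      using le[of y] by eventually_elim auto
  qed measurable
  have H: "integrable (lborel \<Otimes>\<^sub>M lborel) ?H"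
  proof (rule lborel_pair.Fubini_integrable)
    show "integrable lborel (\<lambda>y. LINT x|lborel. norm (?H (y, x)))"
    proof (rule Bochner_Integration.integrable_bound)
      show "integrable lborel (\<lambda>y. norm (f y) * (B * (LINT x|lborel. norm (g x))))"
        by (intro integrable_mult_left integrable_norm f)
      show "AE y in lborel. norm (LINT x|lborel. norm (?H (y, x)))
          \<le> norm (norm (f y) * (B * (LINT x|lborel. norm (g x))))"
      proof (rule AE_I2)
        fix y
        have "(LINT x|lborel. norm (?H (y, x))) \<le> (LINT x|lborel. norm (f y) * (norm (g (x - y)) * B))"
          using sec[of y] dom[of y] le[of y] by (intro integral_mono_AE) auto
        also have "\<dots> = norm (f y) * (B * (LINT x|lborel. norm (g x)))"
          using integral_lborel_shift[OF integrable_norm[OF g], of y] by simp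
        finally show "norm (LINT x|lborel. norm (?H (y, x)))
          \<le> norm (norm (f y) * (B * (LINT x|lborel. norm (g x))))"
          by (auto intro: order_trans[OF _ abs_ge_self])
      qed
    qed measurable
  qed (auto simp: sec)
  have eq: "conv f g x * h x = (LINT y|lborel. f y * g (x - y) * h x)" for x
    by (simp add: conv_def)
  show ?thesis
    unfolding eq using lborel_pair.Fubini_integral[OF H] by (simp add: mult.assoc)
qed

text \<open>The convolution theorem. Only one factor carries the power of \<open>2 * pi\<close>, so
  a kernel enters through its unnormalised transform, in agreement with the mass-one scaling of
  \<open>gaussian\<close>.\<close>

lemma fourier_conv:
  assumes f: "integrable lborel f" and g: "integrable lborel g"
  shows "fourier (conv f g) x
    = (LINT y|lborel. f y * exp (- (\<i> * complex_of_real (y \<bullet> x)))) * fourier g x"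
proof -
  have [measurable]: "f \<in> borel_measurable borel" "g \<in> borel_measurable borel"
    using f g by (auto dest: borel_measurable_integrable)
  let ?e = "\<lambda>y. exp (- (\<i> * complex_of_real (y \<bullet> x)))"
  have ge: "integrable lborel (\<lambda>z. g z * ?e z)"
    by (rule Bochner_Integration.integrable_bound[OF g]) (auto simp: norm_mult norm_exp_eq_Re)
  have "(LINT z|lborel. g (z - y) * ?e z) = ?e y * (LINT z|lborel. g z * ?e z)" for y
  proof -
    have "(LINT z|lborel. g (z - y) * ?e z) = (LINT z|lborel. ?e y * (g (z - y) * ?e (z - y)))"
      by (intro Bochner_Integration.integral_cong)
        (auto simp: inner_diff_left ring_distribs simp flip: exp_add)
    then show ?thesis
      using integral_lborel_shift[OF ge, of y] by simp
  qed
  moreover have "(LINT z|lborel. conv f g z * ?e z) = (LINT y|lborel. f y * (LINT z|lborel. g (z - y) * ?e z))"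
    by (rule integral_conv_mult[OF f g, of _ 1]) (auto simp: norm_exp_eq_Re)
  ultimately have "(LINT z|lborel. conv f g z * ?e z)
      = (LINT y|lborel. f y * ?e y) * (LINT z|lborel. g z * ?e z)"
    by (simp flip: mult.assoc)
  then show ?thesis
    by (simp add: fourier_def)
qed

text \<open>Dominated convergence along sequences. It supplies the continuous representative that
  Gevrey regularity asks for.\<close>

lemma continuous_on_conv:
  fixes f g :: "'a::euclidean_space \<Rightarrow> complex"
  assumes f: "integrable lborel f" and g: "continuous_on UNIV g" and B: "\<And>x. norm (g x) \<le> B"
  shows "continuous_on UNIV (conv f g)"
proof -
  have [measurable]: "f \<in> borel_measurable borel" "g \<in> borel_measurable borel"
    using f g by (auto dest: borel_measurable_integrable borel_measurable_continuous_onI)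
  have "(\<lambda>n. conv f g (X n)) \<longlonglongrightarrow> conv f g x" if "X \<longlonglongrightarrow> x" for X x
    unfolding conv_def
  proof (rule integral_dominated_convergence)
    show "integrable lborel (\<lambda>y. norm (f y) * B)"
      by (intro integrable_mult_left integrable_norm f)
    show "AE y in lborel. (\<lambda>n. f y * g (X n - y)) \<longlonglongrightarrow> f y * g (x - y)"
      by (intro AE_I2 tendsto_mult tendsto_const continuous_on_tendsto_compose[OF g] tendsto_diff that) auto
    show "AE y in lborel. norm (f y * g (X n - y)) \<le> norm (f y) * B" for n
      by (auto simp: norm_mult intro!: mult_left_mono B)
  qed measurable
  then show ?thesis
    by (auto simp: continuous_on_sequentially comp_def)
qed

subsection \<open>Schwartz functions\<close>

lemma pdiffs_Nil [simp]: "pdiffs [] f = f"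
  by (simp add: pdiffs_def)

lemma pdiffs_Cons: "pdiffs (d # ds) f = pdiff d (pdiffs ds f)"
  by (simp add: pdiffs_def)

lemma pdiffs_pdiffs: "pdiffs ds (pdiffs es f) = pdiffs (ds @ es) f"
  by (simp add: pdiffs_def)

lemma schwartz_functions_pdiffs: "f \<in> schwartz_functions \<Longrightarrow> pdiffs ds f \<in> schwartz_functions"
  by (auto simp: schwartz_functions_def smooth_def pdiffs_pdiffs)

lemma schwartz_functions_pdiff: "f \<in> schwartz_functions \<Longrightarrow> pdiff i f \<in> schwartz_functions"
  using schwartz_functions_pdiffs[of f "[i]"] by (simp add: pdiffs_Cons)

lemma schwartz_functions_bound:
  assumes "f \<in> schwartz_functions"
  obtains C where "C \<ge> 0" "\<And>x. japanese x ^ k * norm (f x) \<le> C"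
proof -
  have "bdd_above (range (\<lambda>x. japanese x ^ k * norm (pdiffs [] f x)))"
    using assms by (auto simp: schwartz_functions_def simp del: pdiffs_Nil)
  then obtain C where C: "\<And>x. japanese x ^ k * norm (f x) \<le> C"
    by (auto simp: bdd_above_def)
  moreover have "0 \<le> C"
    using C[of 0] by (rule order_trans[rotated]) (simp add: less_imp_le)
  ultimately show thesis
    using that by blast
qed

lemma schwartz_functions_differentiable:
  assumes "f \<in> schwartz_functions"
  shows "f differentiable (at x)"
proof -
  have "\<forall>ds. pdiffs ds f differentiable_on UNIV"
    using assms unfolding schwartz_functions_def smooth_def by simp
  from this[rule_format, of "[]"] show ?thesis
    by (simp add: differentiable_on_def)
qed

lemma continuous_on_schwartz: "f \<in> schwartz_functions \<Longrightarrow> continuous_on A f"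
  by (intro differentiable_imp_continuous_on)
    (auto simp: differentiable_on_def intro: differentiable_at_withinI schwartz_functions_differentiable)

lemma borel_measurable_schwartz: "f \<in> schwartz_functions \<Longrightarrow> f \<in> borel_measurable borel"
  by (intro borel_measurable_continuous_onI continuous_on_schwartz)

text \<open>Comparison with the inverse power of the bracket. The almost-everywhere form covers
  \<open>\<Phi>\<close> as well as Schwartz functions.\<close>

lemma integrable_of_japanese_decay:
  fixes F :: "real ^ 'n \<Rightarrow> complex"
  assumes "F \<in> borel_measurable borel"
    and "AE x in lborel. japanese x ^ (2 * CARD('n)) * norm (F x) \<le> C"
  shows "integrable lborel F"
proof (rule Bochner_Integration.integrable_bound)
  show "integrable lborel (\<lambda>x::real^'n. C * inverse (japanese x ^ (2 * CARD('n))))"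
    by (intro integrable_mult_right integrable_inverse_japanese)
  show "AE x in lborel. norm (F x) \<le> norm (C * inverse (japanese x ^ (2 * CARD('n))))"
    using assms(2)
  proof eventually_elim
    case (elim x)
    have "norm (F x) \<le> C / japanese x ^ (2 * CARD('n))"
      using elim by (simp add: pos_le_divide_eq mult.commute)
    then show ?case
      by (simp add: divide_inverse order_trans[OF _ abs_ge_self])
  qed
qed (use assms in simp)

lemma integrable_schwartz:
  fixes f :: "real ^ 'n \<Rightarrow> complex"
  assumes "f \<in> schwartz_functions"
  shows "integrable lborel f"
proof -
  obtain C where C: "C \<ge> 0" "\<And>x. japanese x ^ (2 * CARD('n)) * norm (f x) \<le> C"
    using schwartz_functions_bound[OF assms] by blast
  show ?thesis
    using C(2) by (intro integrable_of_japanese_decay[where C = C] borel_measurable_schwartz assms AE_I2)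
qed

section \<open>Partial derivatives and uniform Taylor bounds\<close>

lemma has_derivative_pdiff:
  assumes "f differentiable (at x)"
  shows "(f has_derivative (\<lambda>h. \<Sum>i\<in>UNIV. h $ i *\<^sub>R pdiff i f x)) (at x)"
proof -
  let ?D = "frechet_derivative f (at x)"
  have D: "(f has_derivative ?D) (at x)"
    using assms by (simp flip: frechet_derivative_works)
  have lin: "linear ?D"
    by (rule has_derivative_linear[OF D])
  have "?D h = (\<Sum>i\<in>UNIV. h $ i *\<^sub>R pdiff i f x)" for h
  proof -
    have "h = (\<Sum>i\<in>UNIV. h $ i *\<^sub>R axis i 1)"
      using basis_expansion[of h] by (simp only: scalar_mult_eq_scaleR)
    then have "?D h = ?D (\<Sum>i\<in>UNIV. h $ i *\<^sub>R axis i 1)"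
      by (rule arg_cong)
    also have "\<dots> = (\<Sum>i\<in>UNIV. h $ i *\<^sub>R pdiff i f x)"
      by (simp only: linear_sum[OF lin] linear_cmul[OF lin] pdiff_def)
    finally show ?thesis .
  qed
  then have "?D = (\<lambda>h. \<Sum>i\<in>UNIV. h $ i *\<^sub>R pdiff i f x)"
    by (rule ext)
  with D show ?thesis
    by simp
qed

text \<open>Uniqueness of the derivative: any expansion of it in coordinates identifies the partial
  derivatives. This is how they are later computed for a convolution.\<close>

lemma pdiff_eqI:
  assumes "(f has_derivative (\<lambda>h. \<Sum>j\<in>UNIV. h $ j *\<^sub>R D j)) (at x)"
  shows "pdiff i f x = D i"
proof -
  have "frechet_derivative f (at x) = (\<lambda>h. \<Sum>j\<in>UNIV. h $ j *\<^sub>R D j)"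
    using frechet_derivative_at[OF assms] by simp
  then have "pdiff i f x = (\<Sum>j\<in>UNIV. axis i 1 $ j *\<^sub>R D j)"
    by (simp add: pdiff_def)
  also have "\<dots> = (\<Sum>j\<in>UNIV. if j = i then D j else 0)"
    by (intro sum.cong) (auto simp: axis_def)
  finally show ?thesis
    by simp
qed

lemma norm_sum_scaleR_component_le:
  fixes h :: "real ^ 'n" and D :: "'n \<Rightarrow> 'a::real_normed_vector"
  shows "norm (\<Sum>i\<in>UNIV. h $ i *\<^sub>R D i) \<le> (\<Sum>i\<in>UNIV. norm (D i)) * norm h"
proof -
  have "norm (\<Sum>i\<in>UNIV. h $ i *\<^sub>R D i) \<le> (\<Sum>i\<in>UNIV. norm (h $ i *\<^sub>R D i))"
    by (rule norm_sum)
  also have "\<dots> \<le> (\<Sum>i\<in>UNIV. norm h * norm (D i))"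
    by (intro sum_mono) (simp add: component_le_norm_cart mult_right_mono)
  finally show ?thesis
    by (simp add: sum_distrib_left mult.commute)
qed

text \<open>The mean value inequality, since all first partial derivatives are bounded.\<close>

lemma schwartz_lipschitz:
  fixes f :: "real ^ 'n \<Rightarrow> complex"
  assumes f: "f \<in> schwartz_functions"
  obtains L where "L \<ge> 0" "\<And>x y. norm (f x - f y) \<le> L * norm (x - y)"
proof -
  have "\<exists>C\<ge>0. \<forall>x. norm (pdiff i f x) \<le> C" for i
    by (rule schwartz_functions_bound[OF schwartz_functions_pdiff[OF f, of i], of 0]) auto
  then obtain C where C: "\<And>i. C i \<ge> 0" "\<And>i x. norm (pdiff i f x) \<le> C i"
    by metis
  have "norm (f x - f y) \<le> (\<Sum>i\<in>UNIV. C i) * norm (x - y)" for x y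
  proof (rule differentiable_bound[where S = UNIV])
    show "(f has_derivative (\<lambda>h. \<Sum>i\<in>UNIV. h $ i *\<^sub>R pdiff i f z)) (at z within UNIV)" for z
      using has_derivative_pdiff[OF schwartz_functions_differentiable[OF f]] by simp
    show "onorm (\<lambda>h. \<Sum>i\<in>UNIV. h $ i *\<^sub>R pdiff i f z) \<le> (\<Sum>i\<in>UNIV. C i)" for z
    proof (rule onorm_le)
      fix h :: "real ^ 'n"
      show "norm (\<Sum>i\<in>UNIV. h $ i *\<^sub>R pdiff i f z) \<le> (\<Sum>i\<in>UNIV. C i) * norm h"
        by (rule order_trans[OF norm_sum_scaleR_component_le])
          (intro mult_right_mono sum_mono C norm_ge_zero)
    qed
  qed auto
  then show thesis
    by (intro that[of "\<Sum>i\<in>UNIV. C i"]) (simp_all add: C sum_nonneg)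
qed

text \<open>The partial derivatives are again Schwartz functions, hence globally Lipschitz. The
  constant is uniform in the base point, so the remainder can be integrated against a
  kernel.\<close>

lemma schwartz_taylor:
  fixes f :: "real ^ 'n \<Rightarrow> complex"
  assumes f: "f \<in> schwartz_functions"
  obtains L where "L \<ge> 0"
    "\<And>x y. norm (f y - f x - (\<Sum>i\<in>UNIV. (y - x) $ i *\<^sub>R pdiff i f x)) \<le> L * (norm (y - x))\<^sup>2"
proof -
  have "\<exists>L\<ge>0. \<forall>x y. norm (pdiff i f x - pdiff i f y) \<le> L * norm (x - y)" for i
    by (rule schwartz_lipschitz[OF schwartz_functions_pdiff[OF f, of i]]) auto
  then obtain L where L: "\<And>i. L i \<ge> 0" "\<And>i x y. norm (pdiff i f x - pdiff i f y) \<le> L i * norm (x - y)"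
    by metis
  let ?D = "\<lambda>z h. \<Sum>i\<in>UNIV. h $ i *\<^sub>R pdiff i f z"
  have "norm (f y - f x - ?D x (y - x)) \<le> norm (y - x) * ((\<Sum>i\<in>UNIV. L i) * norm (y - x))" for x y
  \<comment> \<open>The ball contains the segment from \<open>x\<close> to \<open>y\<close>, and on
    it the derivative differs from that at \<open>x\<close> by at most a multiple of
    \<open>norm (y - x)\<close>.\<close>
  proof (rule differentiable_bound_linearization[where S = "cball x (norm (y - x))"])
    show "x + t *\<^sub>R (y - x) \<in> cball x (norm (y - x))" if "t \<in> {0..1}" for t
      using that by (simp add: dist_norm mult_left_le_one_le)
    show "(f has_derivative ?D z) (at z within cball x (norm (y - x)))" for z
      by (rule has_derivative_at_withinI[OF has_derivative_pdiff[OF schwartz_functions_differentiable[OF f]]])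
    fix z assume "z \<in> cball x (norm (y - x))"
    then have z: "norm (z - x) \<le> norm (y - x)"
      by (simp add: dist_norm norm_minus_commute)
    show "onorm (?D z - ?D x) \<le> (\<Sum>i\<in>UNIV. L i) * norm (y - x)"
    proof (rule onorm_le)
      fix h :: "real ^ 'n"
      have "norm ((?D z - ?D x) h) = norm (\<Sum>i\<in>UNIV. h $ i *\<^sub>R (pdiff i f z - pdiff i f x))"
        by (simp only: minus_apply scaleR_diff_right sum_subtractf)
      also have "\<dots> \<le> (\<Sum>i\<in>UNIV. norm (pdiff i f z - pdiff i f x)) * norm h"
        by (rule norm_sum_scaleR_component_le)
      also have "\<dots> \<le> (\<Sum>i\<in>UNIV. L i * norm (y - x)) * norm h"
      proof (intro mult_right_mono sum_mono norm_ge_zero)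
        fix i
        show "norm (pdiff i f z - pdiff i f x) \<le> L i * norm (y - x)"
          using L(2)[of i z x] mult_left_mono[OF z L(1)[of i]] by linarith
      qed
      finally show "norm ((?D z - ?D x) h) \<le> (\<Sum>i\<in>UNIV. L i) * norm (y - x) * norm h"
        by (simp only: sum_distrib_right)
    qed
  qed simp
  then have "norm (f y - f x - ?D x (y - x)) \<le> (\<Sum>i\<in>UNIV. L i) * (norm (y - x))\<^sup>2" for x y
    by (simp only: power2_eq_square mult.assoc mult.left_commute)
  then show thesis
    by (intro that[of "\<Sum>i\<in>UNIV. L i"] sum_nonneg L) 
qed

section \<open>Convolution of a kernel with a Schwartz function\<close>

lemma integrable_conv_schwartz:
  fixes K f :: "real ^ 'n \<Rightarrow> complex"
  assumes K: "integrable lborel K" and f: "f \<in> schwartz_functions"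
  shows "integrable lborel (\<lambda>y. K y * f (x - y))"
proof -
  have [measurable]: "K \<in> borel_measurable borel" "f \<in> borel_measurable borel"
    using K f by (auto dest: borel_measurable_integrable borel_measurable_schwartz)
  obtain C where C: "\<And>x. japanese x ^ 0 * norm (f x) \<le> C"
    using schwartz_functions_bound[OF f] by blast
  show ?thesis
  proof (rule Bochner_Integration.integrable_bound)
    show "integrable lborel (\<lambda>y. norm (K y) * C)"
      by (intro integrable_mult_left integrable_norm K)
    show "AE y in lborel. norm (K y * f (x - y)) \<le> norm (norm (K y) * C)"
      using C by (intro AE_I2) (auto simp: norm_mult intro!: mult_left_mono order_trans[OF _ abs_ge_self])
  qed measurable
qed

text \<open>Differentiation under the integral sign: the uniform quadratic Taylor remainder of
  \<open>f\<close>, integrated against \<open>norm (K y)\<close>, is at most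
  \<open>M * (norm (z - x))\<^sup>2\<close>, so the difference quotient has an error of order
  \<open>norm (z - x)\<close>.\<close>

lemma has_derivative_conv_schwartz:
  fixes K f :: "real ^ 'n \<Rightarrow> complex"
  assumes K: "integrable lborel K" and f: "f \<in> schwartz_functions"
  shows "(conv K f has_derivative (\<lambda>h. \<Sum>i\<in>UNIV. h $ i *\<^sub>R conv K (pdiff i f) x)) (at x)"
proof -
  obtain L where L: "L \<ge> 0"
    "\<And>x y. norm (f y - f x - (\<Sum>i\<in>UNIV. (y - x) $ i *\<^sub>R pdiff i f x)) \<le> L * (norm (y - x))\<^sup>2"
    using schwartz_taylor[OF f] by blast
  let ?D = "\<lambda>h. \<Sum>i\<in>UNIV. h $ i *\<^sub>R conv K (pdiff i f) x"
  define M where "M = (LINT y|lborel. norm (K y)) * L"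
  have int: "integrable lborel (\<lambda>y. K y * f (z - y))" "integrable lborel (\<lambda>y. K y * pdiff i f (z - y))" for z i
    using f by (auto intro!: integrable_conv_schwartz K schwartz_functions_pdiff)
  show ?thesis
  proof (rule has_derivativeI_sandwich[where e = 1 and H = "\<lambda>z. M * norm (z - x)"])
    show "bounded_linear ?D"
      by (intro bounded_linear_sum bounded_linear_compose[OF bounded_linear_scaleR_left] bounded_linear_vec_nth)
    show "((\<lambda>z. M * norm (z - x)) \<longlongrightarrow> 0) (at x)"
      by (auto intro!: tendsto_eq_intros)
    fix z assume "z \<noteq> x"
    let ?R = "\<lambda>y. f (z - y) - f (x - y) - (\<Sum>i\<in>UNIV. (z - x) $ i *\<^sub>R pdiff i f (x - y))"
    have R: "norm (?R y) \<le> L * (norm (z - x))\<^sup>2" for y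
      using L(2)[of "z - y" "x - y"] by simp
    have KR: "(\<lambda>y. K y * ?R y) = (\<lambda>y. K y * f (z - y) - K y * f (x - y)
        - (\<Sum>i\<in>UNIV. (z - x) $ i *\<^sub>R (K y * pdiff i f (x - y))))"
      by (simp add: fun_eq_iff right_diff_distrib sum_distrib_left)
    have intR: "integrable lborel (\<lambda>y. K y * ?R y)"
      unfolding KR by (intro Bochner_Integration.integrable_diff Bochner_Integration.integrable_sum
          integrable_scaleR_right int)
    have "conv K f z - conv K f x - ?D (z - x) = (LINT y|lborel. K y * ?R y)"
    proof -
      have "(LINT y|lborel. K y * ?R y) = (LINT y|lborel. K y * f (z - y)) - (LINT y|lborel. K y * f (x - y))
          - (LINT y|lborel. (\<Sum>i\<in>UNIV. (z - x) $ i *\<^sub>R (K y * pdiff i f (x - y))))"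
        unfolding KR
        by (subst Bochner_Integration.integral_diff
            | intro Bochner_Integration.integrable_diff Bochner_Integration.integrable_sum
                integrable_scaleR_right int refl)+
      also have "(LINT y|lborel. (\<Sum>i\<in>UNIV. (z - x) $ i *\<^sub>R (K y * pdiff i f (x - y)))) = ?D (z - x)"
        by (subst Bochner_Integration.integral_sum)
          (simp_all only: integrable_scaleR_right int integral_scaleR_right conv_def)
      finally show ?thesis
        by (simp only: conv_def)
    qed
    also have "norm \<dots> \<le> (LINT y|lborel. norm (K y) * (L * (norm (z - x))\<^sup>2))"
    proof (rule order_trans[OF integral_norm_bound integral_mono])
      show "integrable lborel (\<lambda>y. norm (K y * ?R y))"
        by (intro integrable_norm intR)
      show "integrable lborel (\<lambda>y. norm (K y) * (L * (norm (z - x))\<^sup>2))"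
        by (intro integrable_mult_left integrable_norm K)
      show "norm (K y * ?R y) \<le> norm (K y) * (L * (norm (z - x))\<^sup>2)" for y
        unfolding norm_mult by (intro mult_left_mono R norm_ge_zero)
    qed
    also have "\<dots> = M * norm (z - x) * norm (z - x)"
      by (simp add: M_def power2_eq_square ac_simps)
    finally show "norm (conv K f z - conv K f x - ?D (z - x)) / norm (z - x) \<le> M * norm (z - x)"
      using \<open>z \<noteq> x\<close> by (simp add: divide_le_eq)
  qed auto
qed

lemma pdiffs_conv:
  assumes K: "integrable lborel K" and f: "f \<in> schwartz_functions"
  shows "pdiffs ds (conv K f) = conv K (pdiffs ds f)"
proof (induction ds)
  case (Cons d ds)
  show ?case
    unfolding pdiffs_Cons Cons
    by (intro ext pdiff_eqI has_derivative_conv_schwartz K schwartz_functions_pdiffs f)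
qed simp

text \<open>All derivatives fall on \<open>f\<close>, and Peetre's inequality splits the weight at
  \<open>x\<close> between \<open>y\<close>, where the moments of \<open>K\<close> absorb it, and
  \<open>x - y\<close>, where the decay of \<open>f\<close> does.\<close>

lemma schwartz_conv:
  fixes K f :: "real ^ 'n \<Rightarrow> complex"
  assumes K: "K \<in> borel_measurable borel" "\<And>k. integrable lborel (\<lambda>x. japanese x ^ k * norm (K x))"
    and f: "f \<in> schwartz_functions"
  shows "conv K f \<in> schwartz_functions"
proof -
  \<comment> \<open>This is the moment of order 0.\<close>
  have K': "integrable lborel K"
    using K(2)[of 0] K(1) by (simp add: integrable_norm_iff)
  have smooth: "smooth (conv K f)"
    unfolding smooth_def differentiable_on_def pdiffs_conv[OF K' f] differentiable_def
    using has_derivative_conv_schwartz[OF K' schwartz_functions_pdiffs[OF f]]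
    by blast
  have bdd: "bdd_above (range (\<lambda>x. japanese x ^ k * norm (conv K g x)))"
    if g: "g \<in> schwartz_functions" for k g
  proof -
    obtain C where C: "C \<ge> 0" "\<And>x. japanese x ^ k * norm (g x) \<le> C"
      using schwartz_functions_bound[OF g] by blast
    define B where "B = (LINT y|lborel. sqrt 2 ^ k * C * (japanese y ^ k * norm (K y)))"
    have "japanese x ^ k * norm (conv K g x) \<le> B" for x
    proof -
      have "japanese x ^ k * norm (conv K g x) \<le> japanese x ^ k * (LINT y|lborel. norm (K y * g (x - y)))"
        unfolding conv_def by (intro mult_left_mono integral_norm_bound) (simp add: less_imp_le)
      also have "\<dots> = (LINT y|lborel. japanese x ^ k * norm (K y * g (x - y)))"
        by simp
      also have "\<dots> \<le> B"
        unfolding B_def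
      proof (rule integral_mono)
        show "integrable lborel (\<lambda>y. japanese x ^ k * norm (K y * g (x - y)))"
          by (intro integrable_mult_right integrable_norm integrable_conv_schwartz K' g)
        show "integrable lborel (\<lambda>y. sqrt 2 ^ k * C * (japanese y ^ k * norm (K y)))"
          by (intro integrable_mult_right K)
        fix y
        have "japanese x ^ k * norm (K y * g (x - y))
            \<le> sqrt 2 ^ k * japanese y ^ k * japanese (x - y) ^ k * norm (K y * g (x - y))"
          by (intro mult_right_mono japanese_diff_power_le) simp
        also have "\<dots> = sqrt 2 ^ k * japanese y ^ k * norm (K y) * (japanese (x - y) ^ k * norm (g (x - y)))"
          by (simp add: norm_mult)
        also have "\<dots> \<le> sqrt 2 ^ k * japanese y ^ k * norm (K y) * C"
          by (intro mult_left_mono C) (simp add: less_imp_le)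
        finally show "japanese x ^ k * norm (K y * g (x - y)) \<le> sqrt 2 ^ k * C * (japanese y ^ k * norm (K y))"
          by (simp add: ac_simps)
      qed
      finally show ?thesis .
    qed
    then show ?thesis
      by (auto simp: bdd_above_def)
  qed
  have "\<forall>k ds. bdd_above (range (\<lambda>x. japanese x ^ k * norm (pdiffs ds (conv K f) x)))"
    unfolding pdiffs_conv[OF K' f] by (intro allI bdd schwartz_functions_pdiffs f)
  with smooth show ?thesis
    unfolding schwartz_functions_def by blast
qed

subsection \<open>Decay of the localised Fourier transform\<close>

text \<open>The kernel \<open>K\<close> of the proof idea when \<open>a = N\<close>; the phase moves
  the centre of its Fourier transform to \<open>x0\<close>.\<close>

definition mod_gaussian :: "real ^ 'n \<Rightarrow> real \<Rightarrow> real ^ 'n \<Rightarrow> complex" where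
  "mod_gaussian x0 a y = complex_of_real (gaussian a y) * exp (\<i> * complex_of_real (x0 \<bullet> y))"

lemma norm_mod_gaussian: "a \<ge> 0 \<Longrightarrow> norm (mod_gaussian x0 a y) = gaussian a y"
  by (simp add: mod_gaussian_def norm_mult norm_exp_eq_Re)

lemma continuous_on_mod_gaussian [continuous_intros]:
  "continuous_on A f \<Longrightarrow> continuous_on A (\<lambda>x. mod_gaussian x0 a (f x))"
  unfolding mod_gaussian_def by (intro continuous_intros)

lemma borel_measurable_mod_gaussian [measurable]: "mod_gaussian x0 a \<in> borel_measurable borel"
  by (intro borel_measurable_continuous_onI continuous_intros)

lemma integrable_mod_gaussian:
  assumes "a > 0"
  shows "integrable lborel (mod_gaussian x0 a)"
  by (rule Bochner_Integration.integrable_bound[OF integrable_gaussian[OF assms]])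
    (use assms in \<open>auto simp: norm_mod_gaussian\<close>)

text \<open>This makes the convolution admissible as an argument in \<open>tempered_is_fun\<close>,
  which speaks of Schwartz functions only.\<close>

lemma schwartz_conv_mod_gaussian:
  assumes "a > 0" "\<phi> \<in> schwartz_functions"
  shows "conv (mod_gaussian x0 a) \<phi> \<in> schwartz_functions"
  using assms by (intro schwartz_conv) (auto simp: norm_mod_gaussian integrable_japanese_power_gaussian)

text \<open>The phase turns the unnormalised transform of the kernel at \<open>x\<close> into that
  of \<open>gaussian N\<close> at \<open>x - x0\<close>, which is the value of
  \<open>gauss x0 N\<close>.\<close>

lemma fourier_conv_mod_gaussian:
  assumes N: "N \<ge> 1" and \<phi>: "\<phi> \<in> schwartz_functions"
  shows "fourier (conv (mod_gaussian x0 (real N)) \<phi>) = (\<lambda>x. gauss x0 N x * fourier \<phi> x)"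
proof
  fix x
  have "(LINT y|lborel. mod_gaussian x0 (real N) y * exp (- (\<i> * complex_of_real (y \<bullet> x))))
      = (LINT y|lborel. complex_of_real (gaussian (real N) y) * exp (- (\<i> * complex_of_real ((x - x0) \<bullet> y))))"
    by (simp add: mod_gaussian_def mult.assoc inner_diff_left inner_commute[of x] algebra_simps flip: exp_add)
  also have "\<dots> = gauss x0 N x"
    using N by (subst integral_gaussian_iexp) (auto simp: gauss_def)
  finally show "fourier (conv (mod_gaussian x0 (real N)) \<phi>) x = gauss x0 N x * fourier \<phi> x"
    using N by (simp add: fourier_conv[OF integrable_mod_gaussian integrable_schwartz[OF \<phi>]])
qed

text \<open>Peetre's inequality moves the weight from \<open>\<xi>\<close> to \<open>\<eta>\<close>
  and \<open>\<eta> - \<xi>\<close>; the first part is absorbed by the decay of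
  \<open>\<Phi>\<close>, the second by the Gaussian. The resulting bound is free of
  \<open>N\<close>.\<close>

lemma mod_gaussian_integral_decay:
  fixes \<Phi> :: "real ^ 'n \<Rightarrow> complex"
  assumes n: "n \<le> N" and N: "N \<ge> 1" and \<Phi>: "integrable lborel \<Phi>"
    and B: "AE \<eta> in lborel. japanese \<eta> ^ n * norm (\<Phi> \<eta>) \<le> B"
  shows "japanese \<xi> ^ n * norm (LINT \<eta>|lborel. \<Phi> \<eta> * mod_gaussian x0 (real N) (\<eta> - \<xi>))
    \<le> sqrt 2 ^ n * B * sqrt 2 ^ CARD('n)"
proof -
  let ?G = "\<lambda>\<eta>. \<Phi> \<eta> * mod_gaussian x0 (real N) (\<eta> - \<xi>)"
  have [measurable]: "\<Phi> \<in> borel_measurable borel"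
    using \<Phi> by (auto dest: borel_measurable_integrable)
  have half: "real N / 2 > 0"
    using N by simp
  have intG: "integrable lborel ?G"
  proof (rule Bochner_Integration.integrable_bound)
    show "integrable lborel (\<lambda>\<eta>. norm (\<Phi> \<eta>) * sqrt (real N / pi) ^ CARD('n))"
      by (intro integrable_mult_left integrable_norm \<Phi>)
    show "AE \<eta> in lborel. norm (?G \<eta>) \<le> norm (norm (\<Phi> \<eta>) * sqrt (real N / pi) ^ CARD('n))"
      by (intro AE_I2) (simp add: norm_mult norm_mod_gaussian mult_left_mono gaussian_le)
  qed measurable
  \<comment> \<open>Here \<open>n \<le> N\<close> enters: the weight consumes no more than half of
    the exponent of the Gaussian.\<close>
  have gauss: "japanese z ^ n * gaussian (real N) z \<le> sqrt 2 ^ CARD('n) * gaussian (real N / 2) z" for z :: "real ^ 'n"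
  proof -
    have "japanese z ^ n \<le> japanese z ^ N"
      by (rule power_increasing[OF n japanese_ge_1])
    also have "\<dots> \<le> exp (real N / 2 * (norm z)\<^sup>2)"
      using japanese_power_le_exp[of z N] by simp
    finally have "japanese z ^ n * gaussian (real N) z \<le> exp (real N / 2 * (norm z)\<^sup>2) * gaussian (real N) z"
      by (rule mult_right_mono) simp
    also have "\<dots> = sqrt 2 ^ CARD('n) * gaussian (real N / 2) z"
      using gaussian_mult_exp[of "real N / 2" z] by (simp add: mult.commute)
    finally show ?thesis .
  qed
  have "japanese \<xi> ^ n * norm (LINT \<eta>|lborel. ?G \<eta>) \<le> japanese \<xi> ^ n * (LINT \<eta>|lborel. norm (?G \<eta>))"
    by (intro mult_left_mono integral_norm_bound) (simp add: less_imp_le)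
  also have "\<dots> = (LINT \<eta>|lborel. japanese \<xi> ^ n * norm (?G \<eta>))"
    by simp
  also have "\<dots> \<le> (LINT \<eta>|lborel. sqrt 2 ^ n * B * sqrt 2 ^ CARD('n) * gaussian (real N / 2) (\<eta> - \<xi>))"
  proof (rule integral_mono_AE)
    show "integrable lborel (\<lambda>\<eta>. japanese \<xi> ^ n * norm (?G \<eta>))"
      by (intro integrable_mult_right integrable_norm intG)
    show "integrable lborel (\<lambda>\<eta>. sqrt 2 ^ n * B * sqrt 2 ^ CARD('n) * gaussian (real N / 2) (\<eta> - \<xi>))"
      by (intro integrable_mult_right integrable_lborel_shift integrable_gaussian half)
    show "AE \<eta> in lborel. japanese \<xi> ^ n * norm (?G \<eta>)
        \<le> sqrt 2 ^ n * B * sqrt 2 ^ CARD('n) * gaussian (real N / 2) (\<eta> - \<xi>)"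
      using B
    proof eventually_elim
      case (elim \<eta>)
      \<comment> \<open>The sign of \<open>B\<close> follows from the bound at the point at
        hand.\<close>
      then have B0: "0 \<le> B"
        by (rule order_trans[rotated]) (simp add: less_imp_le)
      have "japanese \<xi> ^ n * norm (?G \<eta>)
          \<le> sqrt 2 ^ n * japanese \<eta> ^ n * japanese (\<xi> - \<eta>) ^ n * norm (?G \<eta>)"
        by (intro mult_right_mono japanese_diff_power_le norm_ge_zero)
      also have "\<dots> = sqrt 2 ^ n * (japanese \<eta> ^ n * norm (\<Phi> \<eta>))
          * (japanese (\<eta> - \<xi>) ^ n * gaussian (real N) (\<eta> - \<xi>))"
        using japanese_minus[of "\<eta> - \<xi>"] by (simp add: norm_mult norm_mod_gaussian)
      also have "\<dots> \<le> sqrt 2 ^ n * B * (sqrt 2 ^ CARD('n) * gaussian (real N / 2) (\<eta> - \<xi>))"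
        by (intro mult_mono mult_left_mono elim gauss mult_nonneg_nonneg B0) (auto simp: less_imp_le)
      finally show ?case
        by (simp only: mult.assoc)
    qed
  qed
  also have "\<dots> = sqrt 2 ^ n * B * sqrt 2 ^ CARD('n)"
    using integral_lborel_shift[OF integrable_gaussian[OF half], of \<xi>] integral_gaussian[OF half, where 'n='n]
    by simp
  finally show ?thesis .
qed

text \<open>By duality, testing the localised transform on \<open>\<phi>\<close> means testing
  \<open>\<Phi>\<close> on the convolution of \<open>\<phi>\<close> with the kernel, and Fubini's
  theorem moves the kernel back onto \<open>\<Phi>\<close>. The move reflects its argument, whence
  \<open>\<eta> - \<xi>\<close>.\<close>

lemma tempered_is_fun_gauss_mult:
  fixes \<Phi> :: "real ^ 'n \<Rightarrow> complex"
  assumes u: "tempered_is_fun (fourier_dist u) \<Phi>" and N: "N \<ge> 1"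
    and int: "integrable lborel \<Phi>" and B: "AE \<eta> in lborel. norm (\<Phi> \<eta>) \<le> B"
  shows "tempered_is_fun (fourier_dist (mult_dist u (gauss x0 N)))
    (\<lambda>\<xi>. LINT \<eta>|lborel. \<Phi> \<eta> * mod_gaussian x0 (real N) (\<eta> - \<xi>))"
  unfolding tempered_is_fun_def
proof (intro ballI conjI)
  fix \<phi> :: "real ^ 'n \<Rightarrow> complex"
  assume \<phi>: "\<phi> \<in> schwartz_functions"
  let ?K = "mod_gaussian x0 (real N)"
  let ?F = "\<lambda>\<xi>. LINT \<eta>|lborel. \<Phi> \<eta> * ?K (\<eta> - \<xi>)"
  have \<Phi> [measurable]: "\<Phi> \<in> borel_measurable borel"
    using int by (auto dest: borel_measurable_integrable)
  note [measurable] = borel_measurable_schwartz[OF \<phi>]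
  have K: "integrable lborel ?K"
    using N by (intro integrable_mod_gaussian) simp
  \<comment> \<open>With \<open>\<phi>\<close> as first factor, Fubini's theorem leaves
    \<open>\<phi>\<close> outside and pairs the kernel with \<open>\<Phi>\<close> inside.\<close>
  have comm: "conv ?K \<phi> = conv \<phi> ?K"
    by (rule conv_commute) measurable
  have "fourier_dist (mult_dist u (gauss x0 N)) \<phi> = fourier_dist u (conv ?K \<phi>)"
    by (simp only: fourier_dist_def mult_dist_def fourier_conv_mod_gaussian[OF N \<phi>])
  also have "\<dots> = dist_of_fun \<Phi> (conv ?K \<phi>)"
    using u schwartz_conv_mod_gaussian[OF _ \<phi>] N by (simp add: tempered_is_fun_def)
  also have "\<dots> = (LINT x|lborel. conv \<phi> ?K x * \<Phi> x)"
    unfolding comm by (simp add: dist_of_fun_def mult.commute)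
  also have "\<dots> = (LINT \<xi>|lborel. \<phi> \<xi> * (LINT \<eta>|lborel. ?K (\<eta> - \<xi>) * \<Phi> \<eta>))"
    by (rule integral_conv_mult[OF integrable_schwartz[OF \<phi>] K \<Phi> B])
  also have "\<dots> = dist_of_fun ?F \<phi>"
    by (simp add: dist_of_fun_def mult.commute)
  finally show "fourier_dist (mult_dist u (gauss x0 N)) \<phi> = dist_of_fun ?F \<phi>" .
  \<comment> \<open>The decay estimate of order 0.\<close>
  have F: "norm (?F \<xi>) \<le> B * sqrt 2 ^ CARD('n)" for \<xi>
    using mod_gaussian_integral_decay[OF _ N int, of 0 B \<xi> x0] B by simp
  show "integrable lborel (\<lambda>\<xi>. ?F \<xi> * \<phi> \<xi>)"
  proof (rule Bochner_Integration.integrable_bound)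
    show "integrable lborel (\<lambda>\<xi>. B * sqrt 2 ^ CARD('n) * norm (\<phi> \<xi>))"
      by (intro integrable_mult_right integrable_norm integrable_schwartz \<phi>)
    show "AE \<xi> in lborel. norm (?F \<xi> * \<phi> \<xi>) \<le> norm (B * sqrt 2 ^ CARD('n) * norm (\<phi> \<xi>))"
    proof (rule AE_I2)
      fix \<xi>
      have "norm (?F \<xi> * \<phi> \<xi>) \<le> B * sqrt 2 ^ CARD('n) * norm (\<phi> \<xi>)"
        unfolding norm_mult by (intro mult_right_mono F norm_ge_zero)
      then show "norm (?F \<xi> * \<phi> \<xi>) \<le> norm (B * sqrt 2 ^ CARD('n) * norm (\<phi> \<xi>))"
        by (rule order_trans) simp
    qed
  qed measurable
qed

section \<open>From the decay of the Fourier transform to Gevrey regularity\<close>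

lemma E_space_decay:
  fixes g :: "real ^ 'n \<Rightarrow> complex"
  assumes "g \<in> E_space s"
  obtains u \<Phi> h M where "tempered_distribution u" "\<forall>\<psi>\<in>test_functions UNIV. u \<psi> = dist_of_fun g \<psi>"
    "\<Phi> \<in> borel_measurable borel" "tempered_is_fun (fourier_dist u) \<Phi>" "h > 0" "M \<ge> 0"
    "\<forall>n. AE \<xi> in lborel. japanese \<xi> ^ n * norm (\<Phi> \<xi>) \<le> M * fact n powr s / h ^ n"
proof -
  let ?w = "\<lambda>h (\<alpha> :: 'n \<Rightarrow> nat). h ^ (\<Sum>i\<in>UNIV. \<alpha> i) / (\<Prod>i\<in>UNIV. fact (\<alpha> i)) powr s"
  let ?L = "\<lambda>\<Phi> k. Linf_norm (\<lambda>\<xi>. complex_of_real (japanese \<xi> ^ k) * \<Phi> \<xi>)"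
  from assms obtain u \<Phi> h where u: "tempered_distribution u" "\<forall>\<psi>\<in>test_functions UNIV. u \<psi> = dist_of_fun g \<psi>"
      "\<Phi> \<in> borel_measurable borel" "tempered_is_fun (fourier_dist u) \<Phi>" and h: "h > 0"
    and fin: "(SUP \<alpha>. ennreal (?w h \<alpha>) * ?L \<Phi> (\<Sum>i\<in>UNIV. \<alpha> i)) < \<infinity>"
    unfolding E_space_def by auto
  define M where "M = enn2real (SUP \<alpha>. ennreal (?w h \<alpha>) * ?L \<Phi> (\<Sum>i\<in>UNIV. \<alpha> i))"
  have M: "(SUP \<alpha>. ennreal (?w h \<alpha>) * ?L \<Phi> (\<Sum>i\<in>UNIV. \<alpha> i)) = ennreal M"
    using fin unfolding M_def by (intro ennreal_enn2real[symmetric]) simp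
  have "M \<ge> 0"
    by (simp add: M_def)
  have "AE \<xi> in lborel. japanese \<xi> ^ n * norm (\<Phi> \<xi>) \<le> M * fact n powr s / h ^ n" for n
  proof -
    fix i0 :: 'n
    \<comment> \<open>A multi-index concentrated on one coordinate has order \<open>n\<close> and
      factorial \<open>n!\<close>, so such indices already give every order of decay.\<close>
    define \<alpha> where "\<alpha> = (\<lambda>i. if i = i0 then n else 0)"
    have sum: "(\<Sum>i\<in>UNIV. \<alpha> i) = n"
      by (simp add: \<alpha>_def)
    have prod: "(\<Prod>i\<in>UNIV. fact (\<alpha> i)) = (fact n :: real)"
      by (simp add: \<alpha>_def if_distrib[of fact] prod.delta cong: if_cong)
    have "ennreal (?w h \<alpha>) * ?L \<Phi> (\<Sum>i\<in>UNIV. \<alpha> i) \<le> ennreal M"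
      unfolding M[symmetric] by (rule SUP_upper) simp
    then have *: "ennreal (h ^ n / fact n powr s) * ?L \<Phi> n \<le> ennreal M"
      by (simp only: sum prod)
    have "AE \<xi> in lborel. ennreal (norm (complex_of_real (japanese \<xi> ^ n) * \<Phi> \<xi>)) \<le> ?L \<Phi> n"
      unfolding Linf_norm_def by (rule esssup_AE)
    then show ?thesis
    proof eventually_elim
      case (elim \<xi>)
      have "ennreal (h ^ n / fact n powr s) * ennreal (norm (complex_of_real (japanese \<xi> ^ n) * \<Phi> \<xi>)) \<le> ennreal M"
        by (rule order_trans[OF mult_left_mono[OF elim] *]) simp
      then have "ennreal (h ^ n / fact n powr s * (japanese \<xi> ^ n * norm (\<Phi> \<xi>))) \<le> ennreal M"
        using h by (subst ennreal_mult) (simp_all add: norm_mult norm_power less_imp_le)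
      then have "h ^ n / fact n powr s * (japanese \<xi> ^ n * norm (\<Phi> \<xi>)) \<le> M"
        using \<open>M \<ge> 0\<close> by simp
      then have "h ^ n * (japanese \<xi> ^ n * norm (\<Phi> \<xi>)) \<le> M * fact n powr s"
        by (simp add: pos_divide_le_eq)
      then show ?case
        using h by (simp add: pos_le_divide_eq mult.commute)
    qed
  qed
  with u h \<open>M \<ge> 0\<close> show thesis
    using that by blast
qed

text \<open>This is \<open>n! \<le> n ^ n\<close> raised to the power \<open>s\<close>; at
  \<open>n = 0\<close> both sides are 1 by the convention in \<open>gevrey_weight\<close>.\<close>

lemma fact_powr_le_gevrey_weight:
  assumes "s \<ge> 0"
  shows "fact n powr s \<le> gevrey_weight s n"
proof (cases "n = 0")
  case False
  have "fact n powr s \<le> (real n ^ n) powr s"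
  proof (rule powr_mono2[OF assms])
    show "fact n \<le> real n ^ n"
      using fact_le_power[of n, where 'a = real] by (simp only: of_nat_power)
  qed simp
  also have "real n ^ n = real n powr real n"
    using False by (simp add: powr_realpow)
  also have "(real n powr real n) powr s = gevrey_weight s n"
    using False by (simp add: gevrey_weight_def powr_powr mult.commute)
  finally show ?thesis .
qed (simp add: gevrey_weight_def)

text \<open>The witnesses are the tempered extension \<open>u\<close>, the cone of all nonzero
  vectors and \<open>N0 = 1\<close>, so the same choice serves every direction.\<close>

lemma gevrey_regular_point_of_E_space:
  fixes U :: "(real ^ 'n) set"
  assumes s: "s \<ge> 0" and g: "g \<in> E_space s" and eq: "eq_near x0 U f UNIV (dist_of_fun g)" and \<xi>0: "\<xi>0 \<noteq> 0"
  shows "gevrey_regular_point s U f x0 \<xi>0"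
proof -
  obtain u \<Phi> h M where u: "tempered_distribution u" "\<forall>\<psi>\<in>test_functions UNIV. u \<psi> = dist_of_fun g \<psi>"
      and \<Phi>: "\<Phi> \<in> borel_measurable borel" and F: "tempered_is_fun (fourier_dist u) \<Phi>"
    and hM: "h > 0" "M \<ge> 0"
    and "\<forall>n. AE \<xi> in lborel. japanese \<xi> ^ n * norm (\<Phi> \<xi>) \<le> M * fact n powr s / h ^ n"
    using E_space_decay[OF g] by blast
  then have decay: "AE \<xi> in lborel. japanese \<xi> ^ n * norm (\<Phi> \<xi>) \<le> M * fact n powr s / h ^ n" for n
    by blast
  \<comment> \<open>The decay is used at order \<open>2 * CARD('n)\<close>.\<close>
  have int: "integrable lborel \<Phi>"
    by (rule integrable_of_japanese_decay[OF \<Phi> decay])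
  \<comment> \<open>The second entry bounds the base of the \<open>n\<close>-th power in the decay
    estimate, the third the remaining constant, which uses up the extra factor in
    \<open>C ^ (n + 1)\<close>; the entry 1 makes \<open>C\<close> positive.\<close>
  define C where "C = Max {1, sqrt 2 / h, M * sqrt 2 ^ CARD('n)}"
  have C: "1 \<le> C" "sqrt 2 / h \<le> C" "M * sqrt 2 ^ CARD('n) \<le> C"
    unfolding C_def by (auto intro: Max_ge)
  \<comment> \<open>Test functions on \<open>V\<close> are test functions on the whole space, where
    \<open>u\<close> extends \<open>g\<close>.\<close>
  have "u \<phi> = dist_of_fun g \<phi>" if "\<phi> \<in> test_functions V" for V \<phi>
    using u(2) that by (auto simp: test_functions_def)
  then have near: "eq_near x0 U f UNIV u"
    using eq unfolding eq_near_def by simp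
  have cone: "open_cone (UNIV - {0 :: real ^ 'n})"
    by (auto simp: open_cone_def open_delete)
  have bounds: "\<exists>F. continuous_on UNIV F \<and>
           tempered_is_fun (fourier_dist (mult_dist u (gauss x0 N))) F \<and>
           (\<forall>\<xi>\<in>UNIV - {0}. \<forall>n\<le>N. norm (F \<xi>) \<le> C ^ (n + 1) * gevrey_weight s n / japanese \<xi> ^ n)"
    if N: "N \<ge> 1" for N
  proof (intro exI conjI ballI allI impI)
    let ?F = "\<lambda>\<xi>. LINT \<eta>|lborel. \<Phi> \<eta> * mod_gaussian x0 (real N) (\<eta> - \<xi>)"
    have F_conv: "?F = conv \<Phi> (\<lambda>z. mod_gaussian x0 (real N) (- z))"
      by (simp add: conv_def fun_eq_iff)
    show "continuous_on UNIV ?F"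
      unfolding F_conv
      by (rule continuous_on_conv[OF int, of _ "sqrt (real N / pi) ^ CARD('n)"])
        (auto intro!: continuous_intros simp: norm_mod_gaussian gaussian_le)
    show "tempered_is_fun (fourier_dist (mult_dist u (gauss x0 N))) ?F"
      using decay[of 0] by (intro tempered_is_fun_gauss_mult[where B = "M * fact 0 powr s / h ^ 0"] F N int) simp
    fix \<xi> n assume n: "n \<le> N"
    have "japanese \<xi> ^ n * norm (?F \<xi>) \<le> sqrt 2 ^ n * (M * fact n powr s / h ^ n) * sqrt 2 ^ CARD('n)"
      by (rule mod_gaussian_integral_decay[OF n N int decay])
    also have "\<dots> = (sqrt 2 / h) ^ n * (M * sqrt 2 ^ CARD('n)) * fact n powr s"
      by (simp add: power_divide)
    also have "\<dots> \<le> C ^ n * C * gevrey_weight s n"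
      using C hM by (intro mult_mono power_mono fact_powr_le_gevrey_weight s) (auto intro!: mult_nonneg_nonneg)
    finally show "norm (?F \<xi>) \<le> C ^ (n + 1) * gevrey_weight s n / japanese \<xi> ^ n"
      by (simp add: pos_le_divide_eq mult.commute mult.left_commute)
  qed
  show ?thesis
    unfolding gevrey_regular_point_def
  proof (intro exI conjI)
    show "tempered_distribution u" "eq_near x0 U f UNIV u" "open_cone (UNIV - {0 :: real ^ 'n})"
      by fact+
    show "\<xi>0 \<in> UNIV - {0}" "C > 0" "(1::nat) \<le> 1"
      using \<xi>0 C(1) by auto
  qed (use bounds in blast)
qed

theorem corollary3p2:
  fixes s :: real
    and U :: "(real ^ 'n) set"
    and f :: "(real ^ 'n \<Rightarrow> complex) \<Rightarrow> complex"
  assumes "1 / 2 \<le> s" "s < 1"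
    and "open U"
    and "distribution U f"
  shows "(\<forall>x0\<in>U. \<forall>g\<in>E_space s. eq_near x0 U f UNIV (dist_of_fun g) \<longrightarrow>
            (\<forall>\<xi>. \<xi> \<noteq> 0 \<longrightarrow> (x0, \<xi>) \<notin> WF s U f)) \<and>
         fst ` WF s U f \<subseteq> sing_supp s U f"
proof -
  have "s \<ge> 0"
    using assms(1) by simp
  then have "(x0, \<xi>) \<notin> WF s U f" if "g \<in> E_space s" "eq_near x0 U f UNIV (dist_of_fun g)" for x0 g \<xi>
    using gevrey_regular_point_of_E_space[OF _ that] by (auto simp: WF_def)
  then show ?thesis
    \<comment> \<open>The inclusion is the contrapositive: outside the singular support some
      \<open>g\<close> in the space agrees with \<open>f\<close> near the point, which excludes
      every direction from \<open>WF\<close>.\<close>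
    by (fastforce simp: sing_supp_def WF_def)
qed

end
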